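(* Let $M$ be a $3\times3$ monotone matrix with dominance matrix $D(M)=\begin{pmatrix}a&b\\c&d\end{pmatrix}$. Then: \begin{enumerate} \item $a+c\le1$, $b+c\le1$ and $b+d\le1$; \item $ac\le\frac14$, $bc\le\frac14$ and $bd\le\frac14$; \item $\mathrm{tr}[D(M)]=a+d\ge0$; \item $\det[D(M)]=ad-bc\ge-\frac14$. \end{enumerate}
   Context: A stochastic matrix is a (real) entrywise non-negative square matrix each of whose row sums equals $1$. An $n\times n$ monotone matrix is an $n\times n$ stochastic matrix $M=(m_{ij})$ such that $\sum_{j=r}^n m_{lj}\ge\sum_{j=r}^n m_{kj}$ for all $l>k$ in $\{1,\dots,n\}$ and all $r\in\{1,\dots,n\}$. The dominance matrix of an $n\times n$ monotone matrix $M$ is the $(n-1)\times(n-1)$ matrix $D(M)$ with entries $(D(M))_{kl}=\sum_{j=1}^l m_{kj}-\sum_{j=1}^l m_{k+1,j}$ for $k,l\in\{1,\dots,n-1\}$. For $n=3$ this means $a=m_{11}-m_{21}$, $b=(m_{11}+m_{12})-(m_{21}+m_{22})$, $c=m_{21}-m_{31}$, $d=(m_{21}+m_{22})-(m_{31}+m_{32})$. *)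

theory Defs
  imports Complex_Main "Jordan_Normal_Form.Determinant"
begin

(* Matrix indices are 0-based: the entry m_{ij} is M $$ (i - 1, j - 1). *)

definition stochastic_mat :: "nat \<Rightarrow> real mat \<Rightarrow> bool" where
  "stochastic_mat n M \<longleftrightarrow>
     M \<in> carrier_mat n n \<and>
     (\<forall>i<n. \<forall>j<n. 0 \<le> M $$ (i, j)) \<and>
     (\<forall>i<n. (\<Sum>j<n. M $$ (i, j)) = 1)"

definition monotone_mat :: "nat \<Rightarrow> real mat \<Rightarrow> bool" where
  "monotone_mat n M \<longleftrightarrow>
     stochastic_mat n M \<and>
     (\<forall>k l r. k < l \<longrightarrow> l < n \<longrightarrow> r < n \<longrightarrow>
        (\<Sum>j = r..<n. M $$ (l, j)) \<ge> (\<Sum>j = r..<n. M $$ (k, j)))"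

definition dominance_mat :: "real mat \<Rightarrow> real mat" where
  "dominance_mat M = mat (dim_row M - 1) (dim_row M - 1)
     (\<lambda>(k, l). (\<Sum>j\<le>l. M $$ (k, j)) - (\<Sum>j\<le>l. M $$ (k + 1, j)))"

definition mat_trace :: "'a :: comm_monoid_add mat \<Rightarrow> 'a" where
  "mat_trace A = (\<Sum>i<dim_row A. A $$ (i, i))"

end

theory Submission
  imports Defs
begin

text \<open>Since rows sum to 1, the monotonicity of tail sums says that initial sums decrease from
  each row to the next, so \<open>a\<close>, \<open>b\<close>, \<open>c\<close>, \<open>d\<close>
  are nonnegative; this gives the trace bound. In each of \<open>a + c\<close>,
  \<open>b + c\<close>, \<open>b + d\<close> the contributions of the middle row cancel, wholly or
  up to a nonpositive term, leaving at most 1. AM-GM (\<open>mult_le_quarter_of_sum_le_one\<close>)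
  then bounds the products, and the determinant bound follows from \<open>a * d \<ge> 0\<close> and
  \<open>b * c \<le> 1 / 4\<close>.\<close>

text \<open>AM-GM, from \<open>(x - y)\<^sup>2 \<ge> 0\<close>; the signs of \<open>x\<close> and
  \<open>y\<close> are what lets the bound on \<open>x + y\<close> be squared.\<close>

lemma mult_le_quarter_of_sum_le_one:
  fixes x y :: real
  assumes "0 \<le> x" "0 \<le> y" "x + y \<le> 1"
  shows "x * y \<le> 1 / 4"
proof -
  have "(x + y)\<^sup>2 \<le> 1"
    using assms by (intro power_le_one) auto
  moreover have "4 * (x * y) \<le> (x + y)\<^sup>2"
    using zero_le_power2[of "x - y"] by (simp add: power2_eq_square algebra_simps)
  ultimately show ?thesis by simp
qed

text \<open>Laplace expansion along row 0, where both minors are 1-by-1 determinants.\<close>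

lemma det_2:
  fixes A :: "'a :: comm_ring_1 mat"
  assumes "A \<in> carrier_mat 2 2"
  shows "det A = A $$ (0, 0) * A $$ (1, 1) - A $$ (0, 1) * A $$ (1, 0)"
proof -
  have "det (mat_delete A 0 j) = mat_delete A 0 j $$ (0, 0)" for j
    using assms by (intro det_single) (auto simp: mat_delete_def)
  then show ?thesis
    using laplace_expansion_row[OF assms, of 0] assms
    by (simp add: cofactor_def mat_delete_def numeral_2_eq_2)
qed

theorem lemma2p1:
  fixes M :: "real mat" and a b c d :: real
  assumes "monotone_mat 3 M"
    and "dominance_mat M = mat_of_rows_list 2 [[a, b], [c, d]]"
  shows "(a + c \<le> 1 \<and> b + c \<le> 1 \<and> b + d \<le> 1) \<and>
         (a * c \<le> 1 / 4 \<and> b * c \<le> 1 / 4 \<and> b * d \<le> 1 / 4) \<and>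
         (mat_trace (dominance_mat M) = a + d \<and> a + d \<ge> 0) \<and>
         (det (dominance_mat M) = a * d - b * c \<and> a * d - b * c \<ge> - (1 / 4))"
proof -
  let ?D = "dominance_mat M"
  have stoch: "stochastic_mat 3 M"
    using assms(1) by (simp add: monotone_mat_def)
  then have dim: "dim_row M = 3"
    by (auto simp: stochastic_mat_def)
  have nonneg: "0 \<le> M $$ (i, j)" if "i < 3" "j < 3" for i j
    using stoch that by (simp add: stochastic_mat_def)
  have row: "M $$ (i, 0) + M $$ (i, 1) + M $$ (i, 2) = 1" if "i < 3" for i
    using stoch that by (simp add: stochastic_mat_def eval_nat_numeral)
  \<comment> \<open>Consecutive rows suffice, as these are the ones that the dominance matrix
    compares.\<close>
  have mono: "(\<Sum>j = r..<3. M $$ (k, j)) \<le> (\<Sum>j = r..<3. M $$ (Suc k, j))"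
    if "k < 2" "r < 3" for k r
    using assms(1) that by (simp add: monotone_mat_def)

  have entries: "?D $$ (0, 0) = a" "?D $$ (0, 1) = b" "?D $$ (1, 0) = c" "?D $$ (1, 1) = d"
    by (simp_all add: assms(2) mat_of_rows_list_def)
  have a: "a = M $$ (0, 0) - M $$ (1, 0)"
    and b: "b = M $$ (0, 0) + M $$ (0, 1) - (M $$ (1, 0) + M $$ (1, 1))"
    and c: "c = M $$ (1, 0) - M $$ (2, 0)"
    and d: "d = M $$ (1, 0) + M $$ (1, 1) - (M $$ (2, 0) + M $$ (2, 1))"
    by (simp_all add: entries[symmetric] dominance_mat_def dim numeral_2_eq_2)
  note rows = row[of 0] row[of 1] row[of 2]

  \<comment> \<open>The tail from column \<open>r\<close> is 1 minus the sum of the columns before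
    it, so \<open>r = 1\<close> handles \<open>a\<close>, \<open>c\<close> and \<open>r = 2\<close>
    handles \<open>b\<close>, \<open>d\<close>.\<close>
  have "0 \<le> a" "0 \<le> b" "0 \<le> c" "0 \<le> d"
    using mono[of 0 1] mono[of 0 2] mono[of 1 1] mono[of 1 2] rows
    by (simp_all add: a b c d eval_nat_numeral)
  \<comment> \<open>For instance, \<open>b + c\<close> is
    \<open>M $$ (0, 0) + M $$ (0, 1) - M $$ (1, 1) - M $$ (2, 0)\<close>, at most the sum of row
    0.\<close>
  moreover have "a + c \<le> 1" "b + c \<le> 1" "b + d \<le> 1"
    using nonneg[of 0 1] nonneg[of 0 2] nonneg[of 1 1] nonneg[of 2 0] nonneg[of 2 1] rows
    by (simp_all add: a b c d)
  moreover have "a * c \<le> 1 / 4" "b * c \<le> 1 / 4" "b * d \<le> 1 / 4"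
    using calculation by (blast intro: mult_le_quarter_of_sum_le_one)+
  moreover have "0 \<le> a * d"
    using calculation by simp
  moreover have "mat_trace ?D = a + d"
    using entries by (simp add: mat_trace_def dominance_mat_def dim numeral_2_eq_2)
  moreover have "det ?D = a * d - b * c"
    using entries by (subst det_2) (auto simp: dominance_mat_def dim)
  ultimately show ?thesis by linarith
qed

end
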